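(* $c(5,2)\leq 4$, $c(3,3)\leq 4$, $c(6,-1)>4$, and $c(4,3)>4$.
   Context: A finite digraph $D=(V,A)$ is covered by $k$ cuts if there are $U_1,\dots,U_k\subseteq V$ such that every arc $uv\in A$ has some $a$ with $u\in U_a$, $v\notin U_a$; equivalently, there is a labeling $C:V\to\mathcal{P}(\{1,\dots,k\})$ with $C(u)\not\subseteq C(v)$ for every arc $uv$. For integers $\Delta^-,\Delta^+\geq -1$, $\mathcal{D}(\Delta^-,\Delta^+)$ is the class of all finite acyclic digraphs in which every vertex has indegree at most $\Delta^-$ or outdegree at most $\Delta^+$ (so $\mathcal{D}(\Delta^-,-1)$ is the class of acyclic digraphs of maximum indegree at most $\Delta^-$), and $c(\Delta^-,\Delta^+)$ is the smallest $k$ such that every digraph in $\mathcal{D}(\Delta^-,\Delta^+)$ is covered by $k$ cuts. *)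

theory Defs
  imports "Graph_Theory.Pair_Digraph"
begin

definition covered_by_cuts :: "'a pair_pre_digraph \<Rightarrow> nat \<Rightarrow> bool" where
  "covered_by_cuts D k \<longleftrightarrow>
     (\<exists>U :: nat \<Rightarrow> 'a set. (\<forall>a\<in>{1..k}. U a \<subseteq> pverts D) \<and>
        (\<forall>(u, v)\<in>parcs D. \<exists>a\<in>{1..k}. u \<in> U a \<and> v \<notin> U a))"

definition digraph_class :: "int \<Rightarrow> int \<Rightarrow> 'a pair_pre_digraph set" where
  "digraph_class dm dp =
     {D. pair_fin_digraph D \<and> acyclic (parcs D) \<and>
         (\<forall>v\<in>pverts D. int (in_degree D v) \<le> dm \<or> int (out_degree D v) \<le> dp)}"

text \<open>
  Since the digraphs are finite, it suffices to let the vertices be natural numbers;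
  \<open>covered_by_cut_number\<close> below transfers the bound to every vertex type, and
  \<open>ex_cut_bound\<close> shows that the minimum is always attained.
\<close>

definition cut_number :: "int \<Rightarrow> int \<Rightarrow> nat" where
  "cut_number dm dp =
     (LEAST k. \<forall>D \<in> (digraph_class dm dp :: nat pair_pre_digraph set). covered_by_cuts D k)"

lemma greedy_colouring:
  assumes "finite W" "acyclic A" "\<And>v. v \<in> W \<Longrightarrow> card {u\<in>W. (u, v) \<in> A} \<le> d"
  shows "\<exists>f :: 'a \<Rightarrow> nat. (\<forall>v\<in>W. f v \<le> d) \<and> (\<forall>u\<in>W. \<forall>v\<in>W. (u, v) \<in> A \<longrightarrow> f u \<noteq> f v)"
  using assms(1,3)
proof (induction "card W" arbitrary: W)
  case 0
  then show ?case by simp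
next
  case (Suc n)
  let ?R = "A \<inter> W \<times> W"
  have "acyclic ?R" using assms(2) by (rule acyclic_subset) simp
  moreover have "finite ?R" using Suc.prems(1) by blast
  ultimately have wf: "wf (?R\<inverse>)" by (intro finite_acyclic_wf_converse)
  obtain w where "w \<in> W" using Suc.hyps(2) by fastforce
  from wfE_min[OF wf this] obtain s where "s \<in> W" "\<And>x. (x, s) \<in> ?R\<inverse> \<Longrightarrow> x \<notin> W"
    by blast
  then have s: "s \<in> W" "\<And>x. x \<in> W \<Longrightarrow> (s, x) \<notin> A" by blast+
  let ?W = "W - {s}"
  have deg: "card {u\<in>?W. (u, v) \<in> A} \<le> d" if "v \<in> ?W" for v
  proof -
    have "card {u\<in>?W. (u, v) \<in> A} \<le> card {u\<in>W. (u, v) \<in> A}"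
      using Suc.prems(1) by (intro card_mono) auto
    then show ?thesis using Suc.prems(2)[of v] that by simp
  qed
  have "n = card ?W" using Suc s by simp
  moreover have "finite ?W" using Suc.prems(1) by simp
  ultimately obtain f :: "'a \<Rightarrow> nat"
    where f: "\<forall>v\<in>?W. f v \<le> d" "\<forall>u\<in>?W. \<forall>v\<in>?W. (u, v) \<in> A \<longrightarrow> f u \<noteq> f v"
    using Suc.hyps(1)[of ?W, OF _ _ deg] by metis
  let ?N = "{u\<in>W. (u, s) \<in> A}"
  have cN: "card (f ` ?N) \<le> d"
  proof -
    have "card (f ` ?N) \<le> card ?N" using Suc.prems(1) by (intro card_image_le) simp
    also have "\<dots> \<le> d" by (rule Suc.prems(2)[OF s(1)])
    finally show ?thesis .
  qed
  have "\<not> {..d} \<subseteq> f ` ?N"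
  proof -
    have "finite (f ` ?N)" using Suc.prems(1) by simp
    then have "{..d} \<subseteq> f ` ?N \<Longrightarrow> Suc d \<le> card (f ` ?N)"
      using card_mono[of "f ` ?N" "{..d}"] by (simp only: card_atMost)
    with cN show ?thesis by linarith
  qed
  then obtain c where c: "c \<le> d" "c \<notin> f ` ?N" by blast
  have "(f(s := c)) v \<le> d" if "v \<in> W" for v
    using f(1) c(1) that by simp
  moreover have "(f(s := c)) u \<noteq> (f(s := c)) v" if uv: "u \<in> W" "v \<in> W" "(u, v) \<in> A" for u v
  proof -
    have "u \<noteq> s" using s(2) uv by blast
    show ?thesis
    proof (cases "v = s")
      case True
      then have "f u \<in> f ` ?N" using uv by blast
      then have "f u \<noteq> c" using c(2) by metis
      with True \<open>u \<noteq> s\<close> show ?thesis by simp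
    next
      case False
      with \<open>u \<noteq> s\<close> f(2) uv show ?thesis by simp
    qed
  qed
  ultimately show ?case by blast
qed

lemma in_degree_pair: "in_degree (with_proj D) v = card {u. (u, v) \<in> parcs D}"
proof -
  have "in_arcs (with_proj D) v = (\<lambda>u. (u, v)) ` {u. (u, v) \<in> parcs D}"
    by (auto simp: in_arcs_def)
  then show ?thesis by (simp add: in_degree_def card_image inj_on_def)
qed

lemma out_degree_pair: "out_degree (with_proj D) v = card {u. (v, u) \<in> parcs D}"
proof -
  have "out_arcs (with_proj D) v = (\<lambda>u. (v, u)) ` {u. (v, u) \<in> parcs D}"
    by (auto simp: out_arcs_def)
  then show ?thesis by (simp add: out_degree_def card_image inj_on_def)
qed

lemma ex_cut_bound: "\<exists>k. \<forall>D \<in> (digraph_class dm dp :: 'a pair_pre_digraph set). covered_by_cuts D k"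
proof -
  define d where "d = nat dm"
  define e where "e = nat dp"
  have "covered_by_cuts D (d + e + 2)" if D: "D \<in> digraph_class dm dp" for D :: "'a pair_pre_digraph"
  proof -
    let ?A = "parcs D" and ?V = "pverts D"
    interpret pair_fin_digraph D using D by (simp add: digraph_class_def)
    have ac: "acyclic ?A" using D by (simp add: digraph_class_def)
    have fin: "finite ?V" "finite ?A" by (rule pair_finite_verts pair_finite_arcs)+
    have sub: "{u. (u, v) \<in> ?A} \<subseteq> ?V" "{u. (v, u) \<in> ?A} \<subseteq> ?V" for v
      by (blast dest: in_arcsD1 in_arcsD2)+
    have finN: "finite {u. (u, v) \<in> ?A}" "finite {u. (v, u) \<in> ?A}" for v
      by (rule finite_subset[OF sub(1) fin(1)] finite_subset[OF sub(2) fin(1)])+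
    define W where "W = {v \<in> ?V. int (in_degree D v) \<le> dm}"
    have "finite W" using fin by (simp add: W_def)
    have "card {u\<in>W. (u, v) \<in> ?A} \<le> d" if "v \<in> W" for v
    proof -
      have "card {u\<in>W. (u, v) \<in> ?A} \<le> card {u. (u, v) \<in> ?A}"
        using finN by (intro card_mono) auto
      also have "\<dots> \<le> d" using that unfolding W_def in_degree_pair d_def mem_Collect_eq by linarith
      finally show ?thesis .
    qed
    then obtain f :: "'a \<Rightarrow> nat" where f: "\<forall>v\<in>W. f v \<le> d"
        "\<forall>u\<in>W. \<forall>v\<in>W. (u, v) \<in> ?A \<longrightarrow> f u \<noteq> f v"
      using greedy_colouring[OF \<open>finite W\<close> ac] by blast
    have "card {u\<in>?V - W. (u, v) \<in> ?A\<inverse>} \<le> e" if "v \<in> ?V - W" for v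
    proof -
      have "card {u\<in>?V - W. (u, v) \<in> ?A\<inverse>} \<le> card {u. (v, u) \<in> ?A}"
        using finN by (intro card_mono) auto
      also have "int (card {u. (v, u) \<in> ?A}) \<le> dp"
        using that D by (auto simp: W_def digraph_class_def out_degree_pair)
      then have "card {u. (v, u) \<in> ?A} \<le> e" by (simp add: e_def)
      finally show ?thesis .
    qed
    then obtain g :: "'a \<Rightarrow> nat" where g: "\<forall>v\<in>?V - W. g v \<le> e"
        "\<forall>u\<in>?V - W. \<forall>v\<in>?V - W. (u, v) \<in> ?A\<inverse> \<longrightarrow> g u \<noteq> g v"
      using greedy_colouring[OF finite_Diff[OF fin(1)] acyclic_converse[THEN iffD2, OF ac]] by blast
    define h where "h v = (if v \<in> W then Suc (f v) else d + 2 + g v)" for v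
    have "\<exists>a\<in>{1..d + e + 2}. u \<in> {x \<in> ?V. h x = a} \<and> v \<notin> {x \<in> ?V. h x = a}"
      if uv: "(u, v) \<in> ?A" for u v
    proof -
      have "u \<in> ?V" "v \<in> ?V" using uv by (auto dest: in_arcsD1 in_arcsD2)
      moreover have "h u \<in> {1..d + e + 2}"
        using bspec[OF f(1), of u] bspec[OF g(1), of u] \<open>u \<in> ?V\<close> by (cases "u \<in> W") (simp_all add: h_def)
      moreover have "h u \<noteq> h v"
      proof (cases "u \<in> W \<longleftrightarrow> v \<in> W")
        case True
        with f(2) g(2) uv \<open>u \<in> ?V\<close> \<open>v \<in> ?V\<close> show ?thesis
          by (cases "u \<in> W") (auto simp: h_def, metis DiffI converseI)
      next
        case False
        with bspec[OF f(1), of u] bspec[OF f(1), of v] show ?thesis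
          by (auto simp: h_def)
      qed
      ultimately show ?thesis by auto
    qed
    then show ?thesis
      unfolding covered_by_cuts_def by (intro exI[of _ "\<lambda>a. {x \<in> ?V. h x = a}"]) auto
  qed
  then show ?thesis by blast
qed

lemma covered_by_cut_number:
  fixes D :: "'a pair_pre_digraph"
  assumes D: "D \<in> digraph_class dm dp"
  shows "covered_by_cuts D (cut_number dm dp)"
proof -
  let ?A = "parcs D" and ?V = "pverts D"
  interpret pair_fin_digraph D using D by (simp add: digraph_class_def)
  obtain f :: "'a \<Rightarrow> nat" where inj: "inj_on f ?V"
    using finite_imp_inj_to_nat_seg[OF pair_finite_verts] by blast
  define E where "E = \<lparr>pverts = f ` ?V, parcs = map_prod f f ` ?A\<rparr>"
  have pE: "pverts E = f ` ?V" "parcs E = map_prod f f ` ?A" by (auto simp: E_def)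
  have sub: "{u. (u, v) \<in> ?A} \<subseteq> ?V" "{u. (v, u) \<in> ?A} \<subseteq> ?V" for v
    by (blast dest: in_arcsD1 in_arcsD2)+
  have arcE: "(x, y) \<in> parcs E \<longleftrightarrow> (\<exists>u v. (u, v) \<in> ?A \<and> x = f u \<and> y = f v)" for x y
    unfolding pE by force
  have eqD: "u = v" if "f u = f v" "u \<in> ?V" "v \<in> ?V" for u v
    using inj that by (rule inj_onD)
  have ine: "{x. (x, f v) \<in> parcs E} = f ` {u. (u, v) \<in> ?A}" if v: "v \<in> ?V" for v
  proof (intro equalityI subsetI)
    fix x assume "x \<in> {x. (x, f v) \<in> parcs E}"
    then obtain u w where "(u, w) \<in> ?A" "x = f u" "f v = f w" unfolding arcE mem_Collect_eq by blast
    moreover from this have "v = w" by (intro eqD v) (blast dest: in_arcsD2)+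
    ultimately show "x \<in> f ` {u. (u, v) \<in> ?A}" by blast
  qed (use arcE in blast)
  have oute: "{x. (f v, x) \<in> parcs E} = f ` {u. (v, u) \<in> ?A}" if v: "v \<in> ?V" for v
  proof (intro equalityI subsetI)
    fix x assume "x \<in> {x. (f v, x) \<in> parcs E}"
    then obtain u w where "(w, u) \<in> ?A" "x = f u" "f v = f w" unfolding arcE mem_Collect_eq by blast
    moreover from this have "v = w" by (intro eqD v) (blast dest: in_arcsD1)+
    ultimately show "x \<in> f ` {u. (v, u) \<in> ?A}" by blast
  qed (use arcE in blast)
  have deg: "in_degree E (f v) = in_degree D v" "out_degree E (f v) = out_degree D v"
    if "v \<in> ?V" for v
    unfolding in_degree_pair out_degree_pair ine[OF that] oute[OF that]
    by (rule card_image[OF inj_on_subset[OF inj sub(1)]] card_image[OF inj_on_subset[OF inj sub(2)]])+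
  have "pair_fin_digraph E"
    by unfold_locales
      (auto simp: pE pair_finite_verts pair_finite_arcs dest: in_arcsD1 in_arcsD2)
  moreover have "acyclic (parcs E)"
  proof -
    have "wf (?A)" using D pair_finite_arcs by (auto simp: digraph_class_def intro: finite_acyclic_wf)
    then have "wf (inv_image ?A (inv_into ?V f))" by (rule wf_inv_image)
    moreover have "parcs E \<subseteq> inv_image ?A (inv_into ?V f)"
    proof clarify
      fix x y assume "(x, y) \<in> parcs E"
      then obtain u v where "(u, v) \<in> ?A" "x = f u" "y = f v" unfolding arcE by blast
      moreover from this have "u \<in> ?V" "v \<in> ?V" by (blast dest: in_arcsD1 in_arcsD2)+
      ultimately show "(x, y) \<in> inv_image ?A (inv_into ?V f)"
        using inj by (simp add: in_inv_image inv_into_f_f)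
    qed
    ultimately show ?thesis using wf_acyclic wf_subset by blast
  qed
  ultimately have "E \<in> digraph_class dm dp"
    using D deg by (auto simp: digraph_class_def pE)
  then have "covered_by_cuts E (cut_number dm dp)"
    unfolding cut_number_def using LeastI_ex[OF ex_cut_bound[where 'a = nat, of dm dp]] by blast
  then obtain U where U: "\<forall>(x, y)\<in>parcs E. \<exists>a\<in>{1..cut_number dm dp}. x \<in> U a \<and> y \<notin> U a"
    by (auto simp: covered_by_cuts_def)
  have "\<exists>a\<in>{1..cut_number dm dp}. u \<in> {x \<in> ?V. f x \<in> U a} \<and> v \<notin> {x \<in> ?V. f x \<in> U a}"
    if "(u, v) \<in> ?A" for u v
  proof -
    have "(f u, f v) \<in> parcs E" "u \<in> ?V" using that by (auto simp: pE dest: in_arcsD1)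
    then show ?thesis using U by blast
  qed
  then show ?thesis
    unfolding covered_by_cuts_def by (intro exI[of _ "\<lambda>a. {x \<in> ?V. f x \<in> U a}"]) auto
qed

end

theory Submission
  imports Defs "HOL-Library.Nat_Bijection"
begin

text \<open>
  Call a vertex a head vertex if its indegree is small, and a tail vertex otherwise. For the upper bounds
  head vertices are labeled greedily along the arcs and tail vertices against them. For \<open>c(5,2)\<close>
  head vertices get pairs and tail vertices singletons; the only obstruction is a tail vertex
  with two complementary out-neighbours, and avoiding it costs one pair per in-arc. For
  \<open>c(3,3)\<close> head vertices use the labels 14, 24, 34 and, if needed, 123, and tail vertices use 23, 13, 12 and, if needed, 4.

  For the lower bounds, natural numbers with binary expansions as in-neighbourhoods form universal
  digraphs of bounded indegree. The labels used on a suitable initial segment are not dominated by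
  \<open>d\<close> of them, where \<open>d\<close> is the indegree bound. Six chains cover the subsets of a 4-set, which excludes \<open>d = 6\<close>; for
  \<open>d = 4\<close> at least five of the six pairs occur. Vertices of outdegree at most 3 that receive arcs from all of these use
  precisely the four singletons. Three such vertices forming a transitive tournament, all with an arc
  to \<open>X\<close>, leave at most one element for the label of \<open>X\<close>, so \<open>X\<close> cannot have an arc to all of a second
  copy of these vertices.
\<close>

section \<open>Cut covers as labelings\<close>

text \<open>The cut with index \<open>a\<close> consists of the vertices whose label contains
  \<open>a\<close>. An arc is separated by an element of its tail's label, hence the range condition
  on tails.\<close>

lemma covered_by_cutsI:
  assumes "\<And>u v. (u, v) \<in> parcs D \<Longrightarrow> u \<in> pverts D"
    and "\<And>u v. (u, v) \<in> parcs D \<Longrightarrow> C u \<subseteq> {1..k} \<and> \<not> C u \<subseteq> C v"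
  shows "covered_by_cuts D k"
  unfolding covered_by_cuts_def
proof (intro exI[of _ "\<lambda>a. {v \<in> pverts D. a \<in> C v}"] conjI ballI)
  fix e assume "e \<in> parcs D"
  then obtain u v where e: "e = (u, v)" "(u, v) \<in> parcs D" by (cases e) auto
  then obtain a where "a \<in> C u" "a \<notin> C v" "a \<in> {1..k}" "u \<in> pverts D"
    using assms[OF e(2)] by blast
  then show "case e of (u, v) \<Rightarrow> \<exists>a\<in>{1..k}. u \<in> {v \<in> pverts D. a \<in> C v} \<and> v \<notin> {v \<in> pverts D. a \<in> C v}"
    using e(1) by auto
qed auto

lemma labeling_of_cut_number:
  assumes "D \<in> digraph_class dm dp" "cut_number dm dp \<le> k"
  obtains C :: "'a \<Rightarrow> nat set"
  where "\<And>v. C v \<subseteq> {1..k}" "\<And>u v. (u, v) \<in> parcs D \<Longrightarrow> \<not> C u \<subseteq> C v"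
proof -
  obtain U where U: "\<forall>(u, v)\<in>parcs D. \<exists>a\<in>{1..cut_number dm dp}. u \<in> U a \<and> v \<notin> U a"
    using covered_by_cut_number[OF assms(1)] by (auto simp: covered_by_cuts_def)
  show thesis
  proof
    \<comment> \<open>Indices above \<open>cut_number dm dp\<close> may enter these labels. An index
      that separates an arc still lies in the one label and not in the other.\<close>
    show "{a \<in> {1..k}. v \<in> U a} \<subseteq> {1..k}" for v by auto
    show "\<not> {a \<in> {1..k}. u \<in> U a} \<subseteq> {a \<in> {1..k}. v \<in> U a}" if "(u, v) \<in> parcs D" for u v
    proof -
      obtain a where "a \<in> {1..cut_number dm dp}" "u \<in> U a" "v \<notin> U a" using U \<open>(u, v) \<in> parcs D\<close> by blast
      then show ?thesis using assms(2) by auto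
    qed
  qed
qed

lemma cut_number_le:
  assumes "\<And>D :: nat pair_pre_digraph. D \<in> digraph_class dm dp \<Longrightarrow> covered_by_cuts D k"
  shows "cut_number dm dp \<le> k"
  unfolding cut_number_def by (rule Least_le) (use assms in blast)

lemma digraph_classD:
  assumes "D \<in> digraph_class dm dp"
  shows "finite (pverts D)" "acyclic (parcs D)"
    and "(u, v) \<in> parcs D \<Longrightarrow> u \<in> pverts D" "(u, v) \<in> parcs D \<Longrightarrow> v \<in> pverts D"
    and "v \<in> pverts D \<Longrightarrow> int (card {u. (u, v) \<in> parcs D}) \<le> dm \<or> int (card {w. (v, w) \<in> parcs D}) \<le> dp"
    and "finite {u. (u, v) \<in> parcs D}" "finite {w. (v, w) \<in> parcs D}"
proof -
  interpret pair_fin_digraph D using assms by (simp add: digraph_class_def)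
  show "finite (pverts D)" by (rule pair_finite_verts)
  show "acyclic (parcs D)" using assms by (simp add: digraph_class_def)
  show a: "(u, v) \<in> parcs D \<Longrightarrow> u \<in> pverts D" "(u, v) \<in> parcs D \<Longrightarrow> v \<in> pverts D" for u v
    by (blast dest: in_arcsD1 in_arcsD2)+
  show "v \<in> pverts D \<Longrightarrow> int (card {u. (u, v) \<in> parcs D}) \<le> dm \<or> int (card {w. (v, w) \<in> parcs D}) \<le> dp"
    using assms by (auto simp: digraph_class_def in_degree_pair out_degree_pair)
  show "finite {u. (u, v) \<in> parcs D}" "finite {w. (v, w) \<in> parcs D}"
    by (rule finite_subset[OF _ pair_finite_verts]; use a in blast)+
qed

lemma digraph_classI:
  assumes "finite (pverts D)" "parcs D \<subseteq> pverts D \<times> pverts D" "parcs D \<subseteq> measure r"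
    and "\<And>v. v \<in> pverts D \<Longrightarrow>
      int (card {u. (u, v) \<in> parcs D}) \<le> dm \<or> int (card {w. (v, w) \<in> parcs D}) \<le> dp"
  shows "D \<in> digraph_class dm dp"
proof -
  have "finite (parcs D)" using finite_subset[OF assms(2)] assms(1) by simp
  then have "pair_fin_digraph D" using assms(1,2) by unfold_locales auto
  moreover have "acyclic (parcs D)" by (intro wf_acyclic wf_subset[OF wf_measure assms(3)])
  ultimately show ?thesis using assms(4) by (simp add: digraph_class_def in_degree_pair out_degree_pair)
qed

section \<open>Greedy labelings\<close>

text \<open>Every nonempty finite induced subdigraph has a sink. When \<open>W\<close> is built by
  adding sinks, a new vertex meets only in-neighbours among the earlier ones, which is what greedy
  choices need.\<close>

lemma finite_acyclic_sink_induct [consumes 2, case_names empty insert]: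
  assumes "finite W" "acyclic A" "P {}"
    and step: "\<And>W s. finite W \<Longrightarrow> s \<notin> W \<Longrightarrow> \<forall>x\<in>insert s W. (s, x) \<notin> A \<Longrightarrow> P W \<Longrightarrow> P (insert s W)"
  shows "P W"
  using assms(1)
proof (induction "card W" arbitrary: W)
  case 0
  then show ?case using assms(3) by simp
next
  case (Suc n)
  let ?R = "A \<inter> W \<times> W"
  have "acyclic ?R" using assms(2) by (rule acyclic_subset) simp
  moreover have "finite ?R" using Suc.prems by blast
  ultimately have wf: "wf (?R\<inverse>)" by (intro finite_acyclic_wf_converse)
  obtain w where "w \<in> W" using Suc.hyps(2) by fastforce
  from wfE_min[OF wf this] obtain s where s: "s \<in> W" "\<And>x. (x, s) \<in> ?R\<inverse> \<Longrightarrow> x \<notin> W"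
    by blast
  have "P (insert s (W - {s}))"
  proof (rule step)
    show "P (W - {s})" using Suc.hyps(2) Suc.prems s(1) by (intro Suc.hyps(1)) simp_all
    show "\<forall>x\<in>insert s (W - {s}). (s, x) \<notin> A" using s by blast
  qed (use Suc.prems in simp_all)
  then show ?case using s(1) by (simp add: insert_absorb)
qed

lemma ex_notin_of_card_less:
  assumes "finite B" "card B < card L"
  obtains c where "c \<in> L" "c \<notin> B"
  using assms card_mono[OF assms(1), of L] by (meson leD subsetI)

text \<open>The coloured neighbours of a newly added sink are in-neighbours, and they block fewer
  colours than its list has. For the converse relation the count is of out-neighbours.\<close>

lemma greedy_list_colouring:
  fixes L :: "'a \<Rightarrow> 'c set"
  assumes "finite W" "acyclic A" "\<And>v. v \<in> W \<Longrightarrow> card {u\<in>W. (u, v) \<in> A} < card (L v)"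
  obtains f where "\<And>v. v \<in> W \<Longrightarrow> f v \<in> L v"
    "\<And>u v. u \<in> W \<Longrightarrow> v \<in> W \<Longrightarrow> (u, v) \<in> A \<Longrightarrow> f u \<noteq> f v"
proof -
  have "\<exists>f. (\<forall>v\<in>W. f v \<in> L v) \<and> (\<forall>u\<in>W. \<forall>v\<in>W. (u, v) \<in> A \<longrightarrow> f u \<noteq> f v)"
    using assms
  proof (induction W rule: finite_acyclic_sink_induct)
    case (insert W s)
    have "card {u\<in>W. (u, v) \<in> A} < card (L v)" if "v \<in> insert s W" for v
    proof -
      have "card {u\<in>W. (u, v) \<in> A} \<le> card {u\<in>insert s W. (u, v) \<in> A}"
        using insert.hyps by (intro card_mono) auto
      then show ?thesis using insert.prems[OF that] by linarith
    qed note less = this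
    then obtain f where f: "\<forall>v\<in>W. f v \<in> L v" "\<forall>u\<in>W. \<forall>v\<in>W. (u, v) \<in> A \<longrightarrow> f u \<noteq> f v"
      using insert.IH by auto
    have "card (f ` {u\<in>W. (u, s) \<in> A}) < card (L s)"
      using card_image_le[of "{u\<in>W. (u, s) \<in> A}" f] less[of s] insert.hyps by simp
    then obtain c where c: "c \<in> L s" "c \<notin> f ` {u\<in>W. (u, s) \<in> A}"
      using ex_notin_of_card_less[of "f ` {u\<in>W. (u, s) \<in> A}"] insert.hyps by auto
    show ?case
      using f c insert.hyps by (intro exI[of _ "f(s := c)"]) auto
  qed simp
  then show thesis using that by blast
qed

text \<open>A 4-set has six pairs, and at most five in-neighbours forbid one each. The last
  conclusion serves the vertices of \<open>Z\<close>: their singletons must avoid the labels of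
  out-neighbours, and complementary pairs would leave no element.\<close>

lemma pairs_greedy_labeling:
  assumes "finite W0" "acyclic A"
    and "\<And>v. v \<in> W0 \<Longrightarrow> finite {u. (u, v) \<in> A} \<and> card {u. (u, v) \<in> A} \<le> 5"
    and "\<And>u. u \<in> Z \<Longrightarrow> finite {w. (u, w) \<in> A} \<and> card {w. (u, w) \<in> A} \<le> 2"
    and "W0 \<inter> Z = {}"
  obtains f :: "'a \<Rightarrow> nat set" where "\<And>v. v \<in> W0 \<Longrightarrow> f v \<subseteq> {1..4} \<and> card (f v) = 2"
    "\<And>u v. u \<in> W0 \<Longrightarrow> v \<in> W0 \<Longrightarrow> (u, v) \<in> A \<Longrightarrow> f u \<noteq> f v"
    "\<And>u v w. u \<in> Z \<Longrightarrow> v \<in> W0 \<Longrightarrow> w \<in> W0 \<Longrightarrow> v \<noteq> w \<Longrightarrow> (u, v) \<in> A \<Longrightarrow> (u, w) \<in> A \<Longrightarrow>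
      f v \<noteq> {1..4} - f w"
proof -
  let ?Q = "\<lambda>W f. (\<forall>v\<in>W. f v \<subseteq> {1..4} \<and> card (f v) = 2) \<and>
    (\<forall>u\<in>W. \<forall>v\<in>W. (u, v) \<in> A \<longrightarrow> f u \<noteq> f v) \<and>
    (\<forall>u\<in>Z. \<forall>v\<in>W. \<forall>w\<in>W. v \<noteq> w \<longrightarrow> (u, v) \<in> A \<longrightarrow> (u, w) \<in> A \<longrightarrow> f v \<noteq> {1..4} - f w)"
  have "W0 \<subseteq> W0 \<longrightarrow> (\<exists>f :: 'a \<Rightarrow> nat set. ?Q W0 f)"
    using assms(1,2)
  proof (induction W0 rule: finite_acyclic_sink_induct[where P = "\<lambda>W. W \<subseteq> W0 \<longrightarrow> (\<exists>f :: 'a \<Rightarrow> nat set. ?Q W f)"])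
    case (insert W s)
    show ?case
    proof
      assume sub: "insert s W \<subseteq> W0"
      then obtain f :: "'a \<Rightarrow> nat set" where f: "?Q W f" using insert.IH by auto
      text \<open>The sink \<open>s\<close> avoids the labels of its in-neighbours in \<open>W\<close> and the complement of the label of
        the other out-neighbour of each in-neighbour in \<open>Z\<close>; this forbids one pair per in-neighbour.\<close>
      define h where "h u = (if u \<in> W then f u else {1..4} - f (THE w. w \<in> W \<and> (u, w) \<in> A))" for u
      let ?L = "{x. x \<subseteq> {1..4::nat} \<and> card x = 2}"
      have in5: "finite {u. (u, s) \<in> A}" "card {u. (u, s) \<in> A} \<le> 5" using assms(3) sub by auto
      have "card ?L = 6" using n_subsets[of "{1..4::nat}" 2] by (simp add: eval_nat_numeral)
      then have "card (h ` {u. (u, s) \<in> A}) < card ?L"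
        using card_image_le[OF in5(1), of h] in5(2) by simp
      then obtain c where c: "c \<in> ?L" "c \<notin> h ` {u. (u, s) \<in> A}"
        using ex_notin_of_card_less[OF finite_imageI[OF in5(1)]] by blast
      \<comment> \<open>A third out-neighbour would break the bound 2, so the description in
        \<open>h\<close> is unique here. Where no such \<open>w\<close> exists its value is
        arbitrary, which still costs at most one pair.\<close>
      have h_Z: "h u = {1..4} - f w" if "u \<in> Z" "(u, s) \<in> A" "w \<in> W" "(u, w) \<in> A" for u w
      proof -
        have "w' = w" if "w' \<in> W" "(u, w') \<in> A" for w'
        proof (rule ccontr)
          assume "w' \<noteq> w"
          then have "card {s, w, w'} = 3" using \<open>w \<in> W\<close> \<open>w' \<in> W\<close> insert.hyps by (auto simp: card_insert_if)
          moreover have "card {s, w, w'} \<le> card {w. (u, w) \<in> A}"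
            using assms(4)[OF \<open>u \<in> Z\<close>] \<open>(u, s) \<in> A\<close> \<open>(u, w) \<in> A\<close> \<open>(u, w') \<in> A\<close> by (intro card_mono) auto
          ultimately show False using assms(4)[OF \<open>u \<in> Z\<close>] by simp
        qed
        then have "(THE w. w \<in> W \<and> (u, w) \<in> A) = w" using that by blast
        moreover have "u \<notin> W" using \<open>u \<in> Z\<close> sub assms(5) by auto
        ultimately show ?thesis by (simp add: h_def)
      qed
      have c_Z: "c \<noteq> {1..4} - f w" "f w \<noteq> {1..4} - c"
        if "u \<in> Z" "(u, s) \<in> A" "w \<in> W" "(u, w) \<in> A" for u w
      proof -
        show "c \<noteq> {1..4} - f w" using c(2) h_Z[OF that] that(2) by auto
        moreover have "f w \<subseteq> {1..4}" using f that(3) by blast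
        ultimately show "f w \<noteq> {1..4} - c" using c(1) by auto
      qed
      have c_W: "c \<noteq> f u" if "u \<in> W" "(u, s) \<in> A" for u
      proof -
        have "h u = f u" using that by (simp add: h_def)
        then show ?thesis using c(2) that by force
      qed
      let ?g = "f(s := c)"
      have g1: "?g v \<subseteq> {1..4} \<and> card (?g v) = 2" if "v \<in> insert s W" for v
        using f c that by auto
      have g2: "?g u \<noteq> ?g v" if "u \<in> insert s W" "v \<in> insert s W" "(u, v) \<in> A" for u v
        using f c_W insert.hyps that by auto
      have g3: "?g v \<noteq> {1..4} - ?g w"
        if "u \<in> Z" "v \<in> insert s W" "w \<in> insert s W" "v \<noteq> w" "(u, v) \<in> A" "(u, w) \<in> A" for u v w
        using f c_Z insert.hyps that by auto
      show "\<exists>f :: 'a \<Rightarrow> nat set. ?Q (insert s W) f"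
        by (intro exI[of _ ?g] conjI ballI impI)
          (rule g1[THEN conjunct1] g1[THEN conjunct2] g2 g3; assumption)+
    qed
  qed simp
  then obtain f :: "'a \<Rightarrow> nat set" where f: "?Q W0 f" by auto
  show thesis
    by (rule that[OF f[THEN conjunct1, rule_format] f[THEN conjunct2, THEN conjunct1, rule_format]
          f[THEN conjunct2, THEN conjunct2, rule_format]])
qed

lemma not_subset_of_card_eq:
  assumes "finite B" "card A = card B" "A \<noteq> B"
  shows "\<not> A \<subseteq> B"
  using assms card_subset_eq by blast

text \<open>With pairs on \<open>W\<close> and singletons on \<open>Z\<close>, labels of equal size
  only have to differ and a pair never lies in a singleton. An arc from \<open>Z\<close> to
  \<open>W\<close> asks that the singleton avoid the pair, which the lists \<open>L\<close>
  ensure.\<close>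

lemma covered_by_cuts_5_2:
  assumes D: "D \<in> digraph_class 5 2"
  shows "covered_by_cuts D 4"
proof -
  note cl = digraph_classD[OF D]
  let ?A = "parcs D"
  define W where "W = {v \<in> pverts D. card {u. (u, v) \<in> ?A} \<le> 5}"
  define Z where "Z = pverts D - W"
  have fin: "finite W" "finite Z" using cl(1) by (auto simp: W_def Z_def)
  have out: "card {w. (u, w) \<in> ?A} \<le> 2" if "u \<in> Z" for u
    using cl(5)[of u] that by (auto simp: W_def Z_def)
  obtain f :: "_ \<Rightarrow> nat set" where f: "\<And>v. v \<in> W \<Longrightarrow> f v \<subseteq> {1..4} \<and> card (f v) = 2"
      "\<And>u v. u \<in> W \<Longrightarrow> v \<in> W \<Longrightarrow> (u, v) \<in> ?A \<Longrightarrow> f u \<noteq> f v"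
      "\<And>u v w. u \<in> Z \<Longrightarrow> v \<in> W \<Longrightarrow> w \<in> W \<Longrightarrow> v \<noteq> w \<Longrightarrow> (u, v) \<in> ?A \<Longrightarrow> (u, w) \<in> ?A \<Longrightarrow>
        f v \<noteq> {1..4} - f w"
    by (rule pairs_greedy_labeling[of W ?A Z]) (use fin cl out in \<open>auto simp: W_def Z_def\<close>)
  define L where "L u = {1..4} - (\<Union>w\<in>{w\<in>W. (u, w) \<in> ?A}. f w)" for u
  have L_less: "card {w\<in>Z. (w, u) \<in> ?A\<inverse>} < card (L u)" if u: "u \<in> Z" for u
  proof -
    let ?O = "{w\<in>W. (u, w) \<in> ?A}" and ?I = "{w\<in>Z. (u, w) \<in> ?A}"
    have "card ?O + card ?I = card (?O \<union> ?I)"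
      using fin by (subst card_Un_disjoint) (auto simp: Z_def)
    also have "\<dots> \<le> card {w. (u, w) \<in> ?A}" by (intro card_mono cl) auto
    finally have le: "card ?O + card ?I \<le> 2" using out[OF u] by linarith
    have finO: "finite ?O" using fin by simp
    have finL: "finite (\<Union>w\<in>?O. f w)"
      using f(1) finO by (auto intro: finite_subset)
    have cL: "card (L u) = 4 - card (\<Union>w\<in>?O. f w)"
      unfolding L_def using f(1) finL by (subst card_Diff_subset) auto
    have "card (\<Union>w\<in>?O. f w) \<le> (\<Sum>w\<in>?O. card (f w))" by (rule card_UN_le[OF finO])
    also have "\<dots> = (\<Sum>w\<in>?O. 2)" using f(1) by (intro sum.cong) auto
    also have "\<dots> = 2 * card ?O" by simp
    finally have le': "card (\<Union>w\<in>?O. f w) \<le> 2 * card ?O" .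
    \<comment> \<open>With \<open>o\<close> out-neighbours in \<open>W\<close>, at least 4 - 2o
      elements are left for at most 2 - o out-neighbours in \<open>Z\<close>. This is enough unless
      o = 2, where the one element needed exists because the two pairs are not
      complementary.\<close>
    have "card ?I < card (L u)"
    proof (cases "card ?O = 2")
      case True
      then obtain v w where vw: "?O = {v, w}" "v \<noteq> w" by (auto simp: card_2_iff)
      then have vw': "v \<in> W" "w \<in> W" "(u, v) \<in> ?A" "(u, w) \<in> ?A" by auto
      have "f v \<union> f w \<noteq> {1..4}"
      proof
        assume eq: "f v \<union> f w = {1..4}"
        have fw: "finite (f v)" "finite (f w)" using f(1)[OF vw'(1)] f(1)[OF vw'(2)] by (auto intro: finite_subset)
        have "card (f v \<inter> f w) = 0"
          using card_Un_Int[OF fw] eq f(1)[OF vw'(1)] f(1)[OF vw'(2)] by simp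
        then have "f v = {1..4} - f w" using eq fw by auto
        with f(3)[OF u vw'(1,2) vw(2) vw'(3,4)] show False by blast
      qed
      then have "L u \<noteq> {}" using f(1)[OF vw'(1)] f(1)[OF vw'(2)] vw(1) by (auto simp: L_def)
      moreover have "finite (L u)" by (simp add: L_def)
      ultimately have "card (L u) > 0" by (simp add: card_gt_0_iff)
      then show ?thesis using True le by linarith
    next
      case False
      then show ?thesis using le le' cL by linarith
    qed
    then show ?thesis by simp
  qed
  obtain g where g: "\<And>u. u \<in> Z \<Longrightarrow> g u \<in> L u"
      "\<And>u v. u \<in> Z \<Longrightarrow> v \<in> Z \<Longrightarrow> (u, v) \<in> ?A\<inverse> \<Longrightarrow> g u \<noteq> g v"
    using greedy_list_colouring[OF fin(2) acyclic_converse[THEN iffD2, OF cl(2)] L_less] by blast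
  define C where "C v = (if v \<in> W then f v else {g v})" for v
  show ?thesis
  proof (rule covered_by_cutsI[of _ C])
    fix u v assume uv: "(u, v) \<in> ?A"
    then have V: "u \<in> W \<or> u \<in> Z" "v \<in> W \<or> v \<in> Z" using cl(3,4) by (auto simp: Z_def)
    have WZ: "W \<inter> Z = {}" by (auto simp: Z_def)
    have "C u \<subseteq> {1..4}" using V f(1)[of u] g(1)[of u] WZ by (auto simp: C_def L_def)
    moreover have "\<not> C u \<subseteq> C v"
    proof (cases "u \<in> W"; cases "v \<in> W")
      assume "u \<in> W" "v \<in> W"
      moreover from this have "finite (f v)" using f(1)[of v] finite_subset by blast
      ultimately show ?thesis using f(1)[of u] f(1)[of v] f(2)[OF _ _ uv] not_subset_of_card_eq[of "f v" "f u"]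
        by (auto simp: C_def)
    next
      assume "u \<in> W" "v \<notin> W"
      then show ?thesis using f(1)[of u] card_mono[of "{g v}" "f u"] by (auto simp: C_def)
    next
      assume "u \<notin> W" "v \<in> W"
      then show ?thesis using V g(1)[of u] uv by (auto simp: C_def L_def)
    next
      assume "u \<notin> W" "v \<notin> W"
      then show ?thesis using V g(2)[of v u] uv by (auto simp: C_def)
    qed
    ultimately show "C u \<subseteq> {1..4} \<and> \<not> C u \<subseteq> C v" by blast
  qed (use cl(3) in blast)
qed

text \<open>Vertices of small indegree get labels in \<open>P\<close>, the others get labels in \<open>Q\<close>. An arc from the second
  kind to the first kind uses up one of the three in-arcs of its head and one of the three out-arcs
  of its tail, so that its ends can avoid \<open>p\<close> and \<open>q\<close>.\<close>
lemma covered_by_cuts_of_two_palettes: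
  fixes P Q :: "nat set set"
  assumes D: "D \<in> digraph_class 3 3"
    and P: "card P = 4" "p \<in> P" "\<And>x. x \<in> P \<Longrightarrow> x \<subseteq> {1..k}"
      "\<And>x y. x \<in> P \<Longrightarrow> y \<in> P \<Longrightarrow> x \<noteq> y \<Longrightarrow> \<not> x \<subseteq> y"
    and Q: "card Q = 4" "q \<in> Q" "\<And>x. x \<in> Q \<Longrightarrow> x \<subseteq> {1..k}"
      "\<And>x y. x \<in> Q \<Longrightarrow> y \<in> Q \<Longrightarrow> x \<noteq> y \<Longrightarrow> \<not> x \<subseteq> y"
    and PQ: "\<And>x y. x \<in> P \<Longrightarrow> y \<in> Q \<Longrightarrow> \<not> x \<subseteq> y"
      "\<And>x y. x \<in> Q - {q} \<Longrightarrow> y \<in> P - {p} \<Longrightarrow> \<not> x \<subseteq> y"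
  shows "covered_by_cuts D k"
proof -
  note cl = digraph_classD[OF D]
  let ?A = "parcs D"
  define W where "W = {v \<in> pverts D. card {u. (u, v) \<in> ?A} \<le> 3}"
  define Z where "Z = pverts D - W"
  have fin: "finite W" "finite Z" using cl(1) by (auto simp: W_def Z_def)
  have WZ: "W \<inter> Z = {}" by (auto simp: Z_def)
  have out: "card {w. (u, w) \<in> ?A} \<le> 3" if "u \<in> Z" for u
    using cl(5)[of u] that by (auto simp: W_def Z_def)
  define L where "L v = (if \<exists>u\<in>Z. (u, v) \<in> ?A then P - {p} else P)" for v
  define M where "M u = (if \<exists>v\<in>W. (u, v) \<in> ?A then Q - {q} else Q)" for u
  have L_less: "card {u\<in>W. (u, v) \<in> ?A} < card (L v)" if v: "v \<in> W" for v
  proof (cases "\<exists>u\<in>Z. (u, v) \<in> ?A")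
    case True
    then have "{u\<in>W. (u, v) \<in> ?A} \<subset> {u. (u, v) \<in> ?A}" using WZ by auto
    then have "card {u\<in>W. (u, v) \<in> ?A} < card {u. (u, v) \<in> ?A}" by (intro psubset_card_mono cl)
    then show ?thesis using True v P(1,2) by (simp add: L_def W_def)
  next
    case False
    have "card {u\<in>W. (u, v) \<in> ?A} \<le> card {u. (u, v) \<in> ?A}" by (intro card_mono cl) blast
    then show ?thesis using False v P(1) by (simp add: L_def W_def)
  qed
  obtain f where f: "\<And>v. v \<in> W \<Longrightarrow> f v \<in> L v"
      "\<And>u v. u \<in> W \<Longrightarrow> v \<in> W \<Longrightarrow> (u, v) \<in> ?A \<Longrightarrow> f u \<noteq> f v"
    using greedy_list_colouring[OF fin(1) cl(2) L_less] by blast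
  have M_less: "card {v\<in>Z. (v, u) \<in> ?A\<inverse>} < card (M u)" if u: "u \<in> Z" for u
  proof (cases "\<exists>v\<in>W. (u, v) \<in> ?A")
    case True
    then have "{v\<in>Z. (u, v) \<in> ?A} \<subset> {v. (u, v) \<in> ?A}" using WZ by auto
    then have "card {v\<in>Z. (u, v) \<in> ?A} < card {v. (u, v) \<in> ?A}" by (intro psubset_card_mono cl)
    then show ?thesis using True out[OF u] Q(1,2) by (simp add: M_def)
  next
    case False
    have "card {v\<in>Z. (u, v) \<in> ?A} \<le> card {v. (u, v) \<in> ?A}" by (intro card_mono cl) blast
    then show ?thesis using False out[OF u] Q(1) by (simp add: M_def)
  qed
  obtain g where g: "\<And>u. u \<in> Z \<Longrightarrow> g u \<in> M u"
      "\<And>u v. u \<in> Z \<Longrightarrow> v \<in> Z \<Longrightarrow> (u, v) \<in> ?A\<inverse> \<Longrightarrow> g u \<noteq> g v"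
    using greedy_list_colouring[OF fin(2) acyclic_converse[THEN iffD2, OF cl(2)] M_less] by blast
  have fP: "f v \<in> P" if "v \<in> W" for v
    using f(1)[OF that] by (auto simp: L_def split: if_splits)
  have gQ: "g u \<in> Q" if "u \<in> Z" for u
    using g(1)[OF that] by (auto simp: M_def split: if_splits)
  define C where "C v = (if v \<in> W then f v else g v)" for v
  show ?thesis
  proof (rule covered_by_cutsI[of _ C])
    fix u v assume uv: "(u, v) \<in> ?A"
    then have V: "u \<in> W \<or> u \<in> Z" "v \<in> W \<or> v \<in> Z" using cl(3,4) by (auto simp: Z_def)
    have "C u \<subseteq> {1..k}" using V P(3)[OF fP, of u] Q(3)[OF gQ, of u] by (auto simp: C_def)
    moreover have "\<not> C u \<subseteq> C v"
    proof (cases "u \<in> W"; cases "v \<in> W")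
      assume a: "u \<in> W" "v \<in> W"
      then show ?thesis using P(4)[OF fP fP f(2)] uv by (simp add: C_def)
    next
      assume a: "u \<in> W" "v \<notin> W"
      then show ?thesis using V PQ(1)[OF fP gQ] by (simp add: C_def)
    next
      assume a: "u \<notin> W" "v \<in> W"
      then have "u \<in> Z" using V by blast
      then have "L v = P - {p}" "M u = Q - {q}" using a uv by (auto simp: L_def M_def)
      then show ?thesis using f(1)[OF a(2)] g(1)[OF \<open>u \<in> Z\<close>] a PQ(2) by (simp add: C_def)
    next
      assume a: "u \<notin> W" "v \<notin> W"
      then have "u \<in> Z" "v \<in> Z" "g u \<noteq> g v" using V g(2)[of v u] uv by auto
      then show ?thesis using Q(4)[OF gQ gQ] a by (simp add: C_def)
    qed
    ultimately show "C u \<subseteq> {1..k} \<and> \<not> C u \<subseteq> C v" by blast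
  qed (use cl(3) in blast)
qed

text \<open>The members of \<open>?Q\<close> are the complements of those of \<open>?P\<close>. The
  only inclusions of a member of \<open>?Q\<close> in one of \<open>?P\<close> are {4} in a pair and
  a pair in {1,2,3}, so setting aside {4} and {1,2,3} removes them all.\<close>

lemma covered_by_cuts_3_3:
  assumes "D \<in> digraph_class 3 3"
  shows "covered_by_cuts D 4"
proof -
  let ?P = "{{1,2,3}, {1,4}, {2,4}, {3,4::nat}}" and ?Q = "{{4}, {2,3}, {1,3}, {1,2::nat}}"
  have card: "card ?P = 4" "card ?Q = 4" by code_simp+
  have sub: "\<forall>x\<in>?P. x \<subseteq> {1..4}" "\<forall>x\<in>?Q. x \<subseteq> {1..4}" by code_simp+
  have P: "\<forall>x\<in>?P. \<forall>y\<in>?P. x \<noteq> y \<longrightarrow> \<not> x \<subseteq> y" by code_simp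
  have Q: "\<forall>x\<in>?Q. \<forall>y\<in>?Q. x \<noteq> y \<longrightarrow> \<not> x \<subseteq> y" by code_simp
  have PQ: "\<forall>x\<in>?P. \<forall>y\<in>?Q. \<not> x \<subseteq> y" by code_simp
  have QP: "\<forall>x\<in>?Q - {{4}}. \<forall>y\<in>?P - {{1,2,3}}. \<not> x \<subseteq> y" by code_simp
  show ?thesis
    by (rule covered_by_cuts_of_two_palettes[OF assms card(1) insertI1 bspec[OF sub(1)] P[rule_format]
          card(2) insertI1 bspec[OF sub(2)] Q[rule_format] PQ[rule_format] QP[rule_format]])
qed

section \<open>Undominated label sets of universal digraphs\<close>

text \<open>The order is a parameter because indegrees lead to \<open>(\<subseteq>)\<close> and
  outdegrees to \<open>(\<supseteq>)\<close>. As \<open>T\<close> may be empty, an undominated set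
  is nonempty.\<close>

definition undominated :: "('l \<Rightarrow> 'l \<Rightarrow> bool) \<Rightarrow> nat \<Rightarrow> 'l set \<Rightarrow> bool" where
  "undominated le d M \<longleftrightarrow> (\<forall>T\<subseteq>M. card T \<le> d \<longrightarrow> (\<exists>x\<in>M. \<forall>t\<in>T. \<not> le t x))"

lemma undominatedD:
  assumes "undominated le d M" "T \<subseteq> M" "card T \<le> d" "\<And>x. x \<in> M \<Longrightarrow> \<exists>t\<in>T. le t x"
  shows False
  using assms unfolding undominated_def by meson

text \<open>Subsets of \<open>{..<stage i}\<close> have their binary codes below
  \<open>stage (Suc i)\<close>. The start at 4 puts the vertices 0, 1, 3 into every stage.\<close>

definition stage :: "nat \<Rightarrow> nat" where
  "stage i = ((^) 2 ^^ i) 4"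

lemma stage_Suc: "stage (Suc i) = 2 ^ stage i"
  by (simp add: stage_def)

lemma stage_mono: "i \<le> j \<Longrightarrow> stage i \<le> stage j"
  by (rule lift_Suc_mono_le[of stage]) (auto simp: stage_Suc intro: less_imp_le)

lemma less_of_mem_set_decode: "m \<in> set_decode n \<Longrightarrow> m < n"
proof -
  assume "m \<in> set_decode n"
  then have "n div 2 ^ m \<noteq> 0" by (auto simp: set_decode_def intro: ccontr)
  then have "2 ^ m \<le> n" by (simp add: div_eq_0_iff)
  then show "m < n" using less_exp[of m] by linarith
qed

lemma set_encode_less: "S \<subseteq> {..<b} \<Longrightarrow> set_encode S < 2 ^ b"
proof -
  assume "S \<subseteq> {..<b}"
  then have "set_encode S \<le> (\<Sum>i<b. 2 ^ i)"
    unfolding set_encode_def by (intro sum_mono2) auto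
  also have "\<dots> < 2 ^ b" by (induction b) auto
  finally show ?thesis .
qed

text \<open>If a dominating set of at most \<open>d\<close> labels occurs among the vertices below \<open>stage i\<close>, then the vertex
  encoding representatives of it has a new label. Hence the number of labels grows with each stage.\<close>
lemma undominated_stage:
  fixes lab :: "nat \<Rightarrow> 'l"
  assumes "finite L" "\<And>n. lab n \<in> L"
    and step: "\<And>m n. n < stage (Suc (card L)) \<Longrightarrow> m \<in> set_decode n \<Longrightarrow> card (set_decode n) \<le> d \<Longrightarrow>
      \<not> le (lab m) (lab n)"
  obtains b where "4 \<le> b" "b \<le> stage (Suc (card L))" "undominated le d (lab ` {..<b})"
proof -
  have "\<exists>i\<le>card L. undominated le d (lab ` {..<stage i})"
  proof (rule ccontr)
    assume contr: "\<not> ?thesis"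
    have "i \<le> card (lab ` {..<stage i})" if "i \<le> Suc (card L)" for i
      using that
    proof (induction i)
      case (Suc i)
      let ?M = "lab ` {..<stage i}" and ?M' = "lab ` {..<stage (Suc i)}"
      from contr Suc.prems have "\<not> undominated le d ?M" by auto
      then obtain T where T: "T \<subseteq> ?M" "card T \<le> d" "\<And>x. x \<in> ?M \<Longrightarrow> \<exists>t\<in>T. le t x"
        by (auto simp: undominated_def)
      \<comment> \<open>One vertex is chosen for each label in \<open>T\<close>, so \<open>S\<close>
        has the size of \<open>T\<close> and its code meets the degree bound in
        \<open>step\<close>.\<close>
      then obtain S where S: "S \<subseteq> {..<stage i}" "inj_on lab S" "T = lab ` S"
        using subset_image_inj[of T lab "{..<stage i}"] by blast
      then have "finite S" "card S \<le> d" using T(2) by (auto simp: card_image intro: finite_subset)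
      let ?n = "set_encode S"
      have n: "?n < stage (Suc i)" using set_encode_less[OF S(1)] by (simp add: stage_Suc)
      have "lab ?n \<notin> ?M"
      proof
        assume "lab ?n \<in> ?M"
        then obtain m where "m \<in> S" "le (lab m) (lab ?n)" using T(3) S(3) by blast
        moreover have "?n < stage (Suc (card L))" using n stage_mono[OF Suc.prems] by linarith
        ultimately show False using step[of ?n m] \<open>finite S\<close> \<open>card S \<le> d\<close> by simp
      qed
      moreover have "lab ?n \<in> ?M'" "?M \<subseteq> ?M'" using n stage_mono[of i "Suc i"] by auto
      ultimately have "card ?M < card ?M'" by (intro psubset_card_mono) auto
      then show ?case using Suc by simp
    qed simp
    from this[of "Suc (card L)"] have "card L < card (lab ` {..<stage (Suc (card L))})" by simp
    moreover have "card (lab ` {..<stage (Suc (card L))}) \<le> card L"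
      using assms(1,2) by (intro card_mono) auto
    ultimately show False by linarith
  qed
  then obtain i where i: "i \<le> card L" "undominated le d (lab ` {..<stage i})" by blast
  show thesis
  proof (rule that)
    show "4 \<le> stage i" using stage_mono[of 0 i] by (simp add: stage_def)
    show "stage i \<le> stage (Suc (card L))" using i by (intro stage_mono) simp
  qed (rule i)
qed

section \<open>Undominated families of subsets of a four-element set\<close>

text \<open>A finite nonempty piece of a chain has its intersection as least member. Taking this
  member for each chain that meets \<open>X\<close> dominates \<open>X\<close>.\<close>

lemma dominating_of_chains:
  assumes "finite X" "X \<subseteq> \<Union>(set Cs)" "\<forall>c\<in>set Cs. \<forall>x\<in>c. \<forall>y\<in>c. x \<subseteq> y \<or> y \<subseteq> x"
  obtains T where "T \<subseteq> X" "card T \<le> length Cs" "\<And>x. x \<in> X \<Longrightarrow> \<exists>t\<in>T. t \<subseteq> x"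
proof
  let ?D = "{c \<in> set Cs. c \<inter> X \<noteq> {}}"
  let ?T = "(\<lambda>c. \<Inter>(c \<inter> X)) ` ?D"
  have least: "\<Inter>(c \<inter> X) \<in> c \<inter> X" if "c \<in> ?D" for c
  proof (rule Inter_in_chain)
    show "subset.chain UNIV (c \<inter> X)" using assms(3) that unfolding subset_chain_def by blast
  qed (use assms(1) that in auto)
  then show "?T \<subseteq> X" by blast
  have "card ?T \<le> card ?D" by (intro card_image_le) simp
  also have "\<dots> \<le> card (set Cs)" by (intro card_mono) auto
  also have "\<dots> \<le> length Cs" by (rule card_length)
  finally show "card ?T \<le> length Cs" .
  show "\<exists>t\<in>?T. t \<subseteq> x" if x: "x \<in> X" for x
  proof -
    obtain c where "c \<in> set Cs" "x \<in> c" using assms(2) x by blast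
    then show ?thesis using x by (intro bexI[of _ "\<Inter>(c \<inter> X)"]) auto
  qed
qed

lemma not_undominated_of_chains:
  assumes "finite X" "X \<subseteq> \<Union>(set Cs)" "\<forall>c\<in>set Cs. \<forall>x\<in>c. \<forall>y\<in>c. x \<subseteq> y \<or> y \<subseteq> x" "length Cs \<le> k"
  shows "\<not> undominated (\<subseteq>) k X"
proof
  assume u: "undominated (\<subseteq>) k X"
  obtain T where "T \<subseteq> X" "card T \<le> length Cs" "\<And>x. x \<in> X \<Longrightarrow> \<exists>t\<in>T. t \<subseteq> x"
    by (rule dominating_of_chains[OF assms(1-3)]) blast
  then show False using undominatedD[OF u, of T] assms(4) by auto
qed

text \<open>The chains form a symmetric chain decomposition: each of the six passes through exactly
  one pair.\<close>

lemma not_undominated_6: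
  assumes "M \<subseteq> Pow {1..4::nat}"
  shows "\<not> undominated (\<subseteq>) 6 M"
proof -
  let ?Cs = "[{{}, {1}, {1,2}, {1,2,3}, {1,2,3,4}}, {{2}, {2,3}, {2,3,4}}, {{3}, {1,3}, {1,3,4}},
    {{4}, {1,4}, {1,2,4}}, {{2,4}}, {{3,4::nat}}]"
  have "Pow {1..4} \<subseteq> \<Union>(set ?Cs)" by code_simp
  then have "M \<subseteq> \<Union>(set ?Cs)" using assms by (rule order_trans[rotated])
  moreover have "\<forall>c\<in>set ?Cs. \<forall>x\<in>c. \<forall>y\<in>c. x \<subseteq> y \<or> y \<subseteq> x" by code_simp
  moreover have "finite M" using assms by (rule finite_subset) simp
  moreover have "length ?Cs \<le> 6" by simp
  ultimately show ?thesis by (intro not_undominated_of_chains)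
qed

text \<open>Naming the four elements reduces the fifteen choices of two pairs to two shapes, so that
  one explicit chain cover per shape will do.\<close>

lemma two_pairs_cases:
  assumes "x \<subseteq> {1..4::nat}" "card x = 2" "y \<subseteq> {1..4}" "card y = 2" "x \<noteq> y"
  obtains a b c d where "{a, b, c, d} = {1..4}" "distinct [a, b, c, d]" "x = {a, b}" "y = {a, c} \<or> y = {c, d}"
proof -
  have "\<exists>a b c d. {a, b, c, d} \<subseteq> {1..4} \<and> distinct [a, b, c, d] \<and> x = {a, b} \<and> (y = {a, c} \<or> y = {c, d})"
  proof (cases "x \<inter> y = {}")
    case True
    obtain a b c d where ab: "x = {a, b}" "a \<noteq> b" and cd: "y = {c, d}" "c \<noteq> d"
      using assms(2,4) unfolding card_2_iff by blast
    then have "{a, b, c, d} \<subseteq> {1..4}" using assms(1,3) by blast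
    moreover have "distinct [a, b, c, d]" using True ab cd by simp
    ultimately show ?thesis using ab cd by blast
  next
    case False
    then obtain a where a: "a \<in> x" "a \<in> y" by blast
    have "card (x - {a}) = 1" "card (y - {a}) = 1" using a assms(2,4) by simp_all
    then obtain b c where b: "x - {a} = {b}" and c: "y - {a} = {c}" by (metis card_1_singletonE)
    have "card ({1..4} - {a, b, c}) > 0"
      using diff_card_le_card_Diff[of "{a, b, c}" "{1..4}"] card_length[of "[a, b, c]"] by simp
    then obtain d where d: "d \<in> {1..4}" "d \<notin> {a, b, c}" by (metis DiffE card_gt_0_iff equals0I)
    have xy: "x = {a, b}" "y = {a, c}" using a b c by blast+
    then have "{a, b, c, d} \<subseteq> {1..4}" using assms(1,3) d(1) by blast
    moreover have "a \<noteq> b" "a \<noteq> c" "b \<noteq> c" using b c assms(5) xy by blast+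
    then have "distinct [a, b, c, d]" using d(2) by simp
    ultimately show ?thesis using xy by blast
  qed
  then obtain a b c d where *: "{a, b, c, d} \<subseteq> {1..4}" "distinct [a, b, c, d]" "x = {a, b}" "y = {a, c} \<or> y = {c, d}"
    by blast
  then have "{a, b, c, d} = {1..4}" by (intro card_subset_eq) auto
  with * show thesis using that by blast
qed

text \<open>The empty set would dominate everything. A singleton \<open>{i}\<close> dominates all
  sets containing \<open>i\<close>, and the others are subsets of a 3-set, which form three chains;
  this makes at most four dominating members.\<close>

lemma undominated_4_card_ge:
  assumes "M \<subseteq> Pow {1..4::nat}" "undominated (\<subseteq>) 4 M" "x \<in> M"
  shows "card x \<ge> 2"
proof (rule ccontr)
  assume "\<not> ?thesis"
  then have "card x = 0 \<or> card x = 1" by linarith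
  moreover have fin: "finite M" using assms(1) by (rule finite_subset) simp
  moreover have "finite x" using assms(1,3) finite_subset by blast
  moreover have "x \<noteq> {}" using undominatedD[OF assms(2), of "{x}"] assms(3) by auto
  ultimately obtain i where i: "x = {i}" by (auto simp: card_1_singleton_iff)
  let ?Cs = "\<lambda>j k l. [{{}, {j}, {j,k}, {j,k,l}}, {{k}, {k,l}}, {{l}, {j,l}}] :: nat set set list"
  have "i \<in> {1..4}" using i assms(1,3) by auto
  then have "card ({1..4} - {i}) = 3" by simp
  then obtain j k l where jkl: "{1..4} - {i} = {j, k, l}" by (auto simp: card_3_iff)
  have chains: "Pow {j, k, l} \<subseteq> \<Union>(set (?Cs j k l))" by (simp add: Pow_insert)
  have "{y \<in> M. i \<notin> y} \<subseteq> \<Union>(set (?Cs j k l))" using assms(1) jkl by (intro order_trans[OF _ chains]) auto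
  moreover have "\<forall>c\<in>set (?Cs j k l). \<forall>x\<in>c. \<forall>y\<in>c. x \<subseteq> y \<or> y \<subseteq> x" by auto
  ultimately obtain T where T: "T \<subseteq> {y \<in> M. i \<notin> y}" "card T \<le> length (?Cs j k l)"
    "\<And>y. y \<in> {y \<in> M. i \<notin> y} \<Longrightarrow> \<exists>t\<in>T. t \<subseteq> y"
    using fin by (elim dominating_of_chains[rotated]) auto
  show False
  proof (rule undominatedD[OF assms(2), of "insert x T"])
    show "card (insert x T) \<le> 4" using T(2) card_insert_le_m1[of 4 T x] by simp
    show "\<exists>t\<in>insert x T. t \<subseteq> y" if "y \<in> M" for y
      using T(3)[of y] that i by (cases "i \<in> y") auto
  qed (use T(1) assms(3) in auto)
qed

text \<open>Without two of the pairs, the sets of size at least two are four pairs, four triples and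
  the whole set. Each of these pairs starts a chain through a triple of its own, and one chain goes
  on to the whole set.\<close>

lemma undominated_4_pairs:
  assumes M: "M \<subseteq> Pow {1..4::nat}" "undominated (\<subseteq>) 4 M"
    and "x \<subseteq> {1..4}" "card x = 2" "y \<subseteq> {1..4}" "card y = 2" "x \<noteq> y"
  shows "x \<in> M \<or> y \<in> M"
proof (rule ccontr)
  assume "\<not> ?thesis"
  then have xy: "M \<subseteq> {z \<in> Pow {1..4}. card z \<ge> 2 \<and> z \<noteq> x \<and> z \<noteq> y}"
    using M undominated_4_card_ge by blast
  have fin: "finite M" using M(1) by (rule finite_subset) simp
  obtain a b c d where abcd: "{a, b, c, d} = {1..4}" "distinct [a, b, c, d]" "x = {a, b}" "y = {a, c} \<or> y = {c, d}"
    using two_pairs_cases[OF assms(3-7)] by blast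
  show False
    using abcd(4)
  proof
    assume y: "y = {a, c}"
    let ?Cs = "[{{b,c}, {a,b,c}, {a,b,c,d}}, {{a,d}, {a,b,d}}, {{c,d}, {a,c,d}}, {{b,d}, {b,c,d}}] :: nat set set list"
    have "M \<subseteq> \<Union>(set ?Cs)"
    proof
      fix z assume "z \<in> M"
      then have "z \<in> Pow {a, b, c, d}" "card z \<ge> 2" "z \<noteq> {a, b}" "z \<noteq> {a, c}"
        using xy unfolding abcd(1,3) y by blast+
      then show "z \<in> \<Union>(set ?Cs)" unfolding Pow_insert by (elim UnE imageE; simp; elim UnE imageE; simp)
    qed
    moreover have "\<forall>c\<in>set ?Cs. \<forall>x\<in>c. \<forall>y\<in>c. x \<subseteq> y \<or> y \<subseteq> x" by auto
    moreover have "length ?Cs \<le> 4" by simp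
    ultimately show False using not_undominated_of_chains[OF fin] M(2) by blast
  next
    assume y: "y = {c, d}"
    let ?Cs = "[{{a,c}, {a,b,c}, {a,b,c,d}}, {{a,d}, {a,c,d}}, {{b,d}, {a,b,d}}, {{b,c}, {b,c,d}}] :: nat set set list"
    have "M \<subseteq> \<Union>(set ?Cs)"
    proof
      fix z assume "z \<in> M"
      then have "z \<in> Pow {a, b, c, d}" "card z \<ge> 2" "z \<noteq> {a, b}" "z \<noteq> {c, d}"
        using xy unfolding abcd(1,3) y by blast+
      then show "z \<in> \<Union>(set ?Cs)" unfolding Pow_insert by (elim UnE imageE; simp; elim UnE imageE; simp)
    qed
    moreover have "\<forall>c\<in>set ?Cs. \<forall>x\<in>c. \<forall>y\<in>c. x \<subseteq> y \<or> y \<subseteq> x" by auto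
    moreover have "length ?Cs \<le> 4" by simp
    ultimately show False using not_undominated_of_chains[OF fin] M(2) by blast
  qed
qed

text \<open>\<open>M\<close> contains at least five of the six pairs, and no member of
  \<open>N\<close> contains a member of \<open>M\<close>. So \<open>N\<close> has no set of size
  three or more and at most one pair. At most three members then dominate \<open>N\<close> from
  above, unless all singletons occur and no pair does.\<close>

lemma undominated_3_dual:
  assumes M: "M \<subseteq> Pow {1..4::nat}" "undominated (\<subseteq>) 4 M"
    and N: "N \<subseteq> Pow {1..4}" "undominated (\<supseteq>) 3 N"
    and MN: "\<And>x y. x \<in> M \<Longrightarrow> y \<in> N \<Longrightarrow> \<not> x \<subseteq> y"
  shows "y \<in> N \<Longrightarrow> card y \<le> 1" "i \<in> {1..4} \<Longrightarrow> {i} \<in> N"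
proof -
  have fin: "finite y" if "y \<in> N" for y using N(1) that finite_subset by blast
  have le2: "card y \<le> 2" if "y \<in> N" for y
  proof (rule ccontr)
    assume "\<not> ?thesis"
    then have "3 \<le> card y" by simp
    then obtain r where r: "r \<subseteq> y" "card r = 3" by (rule obtain_subset_with_card_n)
    then obtain a b c where abc: "r = {a, b, c}" "a \<noteq> b" "a \<noteq> c" "b \<noteq> c" unfolding card_3_iff by blast
    have sub: "{a, b} \<subseteq> y" "{a, c} \<subseteq> y" using r(1) abc(1) by blast+
    have "y \<subseteq> {1..4}" using N(1) that by blast
    note sub4 = order_trans[OF sub(1) this] order_trans[OF sub(2) this]
    have "card {a, b} = 2" "card {a, c} = 2" "{a, b} \<noteq> {a, c}"
      using abc by (simp_all add: doubleton_eq_iff)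
    then show False using undominated_4_pairs[OF M, of "{a, b}" "{a, c}"] MN sub sub4 that by blast
  qed
  have le1: "card y \<le> 1" if "y \<in> N" for y
  proof (rule ccontr)
    assume "\<not> ?thesis"
    then have y2: "card y = 2" using le2[OF that] by linarith
    have y4: "y \<subseteq> {1..4}" using N(1) that by blast
    \<comment> \<open>\<open>y\<close> lies above the empty set and its own two singletons; at most
      two further singletons occur, which makes three sets in all.\<close>
    let ?T = "insert y (N \<inter> (\<lambda>i. {i}) ` ({1..4} - y))"
    show False
    proof (rule undominatedD[OF N(2), of ?T])
      have "card (N \<inter> (\<lambda>i. {i}) ` ({1..4} - y)) \<le> card ((\<lambda>i. {i}) ` ({1..4} - y))"
        by (intro card_mono) auto
      also have "\<dots> \<le> card ({1..4} - y)" by (intro card_image_le) simp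
      also have "\<dots> = 2" using y2 y4 fin[OF that] by (subst card_Diff_subset) auto
      finally show "card ?T \<le> 3" by (simp add: card_insert_if)
      show "\<exists>t\<in>?T. z \<subseteq> t" if z: "z \<in> N" for z
      proof (cases "card z = 2")
        case True
        then have "z = y"
          using undominated_4_pairs[OF M, of y z] y2 y4 N(1) MN z \<open>y \<in> N\<close> by blast
        then show ?thesis by blast
      next
        case False
        then have "card z = 0 \<or> card z = 1" using le2[OF z] by linarith
        then consider "z = {}" | i where "z = {i}" using fin[OF z] by (auto simp: card_1_singleton_iff)
        then show ?thesis
        proof cases
          case (2 i)
          then show ?thesis using z N(1) by (cases "i \<in> y") auto
        qed auto
      qed
    qed (use that in auto)
  qed
  then show "y \<in> N \<Longrightarrow> card y \<le> 1" .
  show "{i} \<in> N" if "i \<in> {1..4}"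
  proof (rule ccontr)
    assume i: "{i} \<notin> N"
    have shape: "z = {} \<or> (\<exists>j\<in>{1..4} - {i}. z = {j})" if z: "z \<in> N" for z
    proof -
      have "card z = 0 \<or> card z = 1" using le1[OF z] by linarith
      then consider "z = {}" | j where "z = {j}" using fin[OF z] by (auto simp: card_1_singleton_iff)
      then show ?thesis using N(1) z i by cases auto
    qed
    show False
    proof (cases "N \<subseteq> {{}}")
      case True
      then have "card N \<le> 1" using card_mono[of "{{}}" N] by simp
      then show False by (intro undominatedD[OF N(2), of N]) auto
    next
      case False
      show False
      proof (rule undominatedD[OF N(2), of "N - {{}}"])
        have "card (N - {{}}) \<le> card ((\<lambda>j. {j}) ` ({1..4} - {i}))"
          using shape by (intro card_mono) auto
        also have "\<dots> \<le> card ({1..4} - {i})" by (intro card_image_le) simp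
        also have "\<dots> = 3" using that by simp
        finally show "card (N - {{}}) \<le> 3" .
        show "\<exists>t\<in>N - {{}}. z \<subseteq> t" if "z \<in> N" for z
          using False that by (cases "z = {}") auto
      qed auto
    qed
  qed
qed

section \<open>Digraphs that need five cuts\<close>

text \<open>Every set of at most \<open>d\<close> vertices is the in-neighbourhood of its binary
  code, if the code is below \<open>n\<close>. Vertices with more ones receive no arc, which bounds
  the indegrees, and all arcs go to larger numbers.\<close>

definition universal_arcs :: "nat \<Rightarrow> nat \<Rightarrow> (nat \<times> nat) set" where
  "universal_arcs d n = {(i, j). j < n \<and> i \<in> set_decode j \<and> card (set_decode j) \<le> d}"

lemma cut_number_6_gt: "cut_number 6 (-1) > 4"
proof (rule ccontr)
  assume "\<not> ?thesis"
  then have le: "cut_number 6 (-1) \<le> 4" by simp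
  \<comment> \<open>There are sixteen possible labels, and the counting in
    \<open>undominated_stage\<close> looks no further than this stage.\<close>
  define n where "n = stage (Suc (card (Pow {1..4::nat})))"
  define D where "D = \<lparr>pverts = {..<n}, parcs = universal_arcs 6 n\<rparr>"
  have "D \<in> digraph_class 6 (-1)"
  proof (rule digraph_classI[of D id])
    show "parcs D \<subseteq> pverts D \<times> pverts D" "parcs D \<subseteq> measure id"
      by (auto simp: D_def universal_arcs_def dest!: less_of_mem_set_decode)
    fix j
    have "card {i. (i, j) \<in> parcs D} \<le> 6"
    proof (cases "card (set_decode j) \<le> 6")
      case True
      have "card {i. (i, j) \<in> parcs D} \<le> card (set_decode j)"
        by (intro card_mono) (auto simp: D_def universal_arcs_def)
      with True show ?thesis by linarith
    qed (simp add: D_def universal_arcs_def)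
    then show "int (card {i. (i, j) \<in> parcs D}) \<le> 6 \<or> int (card {i. (j, i) \<in> parcs D}) \<le> -1" by simp
  qed (simp add: D_def)
  then obtain C :: "nat \<Rightarrow> nat set"
    where C: "\<And>v. C v \<subseteq> {1..4}" "\<And>u v. (u, v) \<in> parcs D \<Longrightarrow> \<not> C u \<subseteq> C v"
    using labeling_of_cut_number[OF _ le] by blast
  obtain b where "undominated (\<subseteq>) 6 (C ` {..<b})"
  proof (rule undominated_stage[of "Pow {1..4}" C 6 "(\<subseteq>)"])
    show "\<not> C i \<subseteq> C j"
      if "j < stage (Suc (card (Pow {1..4::nat})))" "i \<in> set_decode j" "card (set_decode j) \<le> 6" for i j
      using that by (intro C(2)) (simp add: D_def universal_arcs_def n_def)
  qed (use C(1) in auto)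
  moreover have "C ` {..<b} \<subseteq> Pow {1..4}" using C(1) by blast
  ultimately show False using not_undominated_6 by blast
qed

section \<open>The digraph for indegree 4 or outdegree 3\<close>

datatype vert = P nat | R nat | S nat | X

text \<open>\<open>P\<close> is universal for indegree at most 4, and \<open>R\<close> and \<open>S\<close> are universal for outdegree at most 3.
  Under the encoding the vertices 0, 1, 3 of \<open>R\<close> form a transitive tournament with outdegrees 0, 1, 2,
  so each of them can afford an arc to \<open>X\<close>.\<close>
definition arcs43 :: "nat \<Rightarrow> (vert \<times> vert) set" where
  "arcs43 n = map_prod P P ` universal_arcs 4 n \<union>
     map_prod R R ` (universal_arcs 3 n)\<inverse> \<union> map_prod S S ` (universal_arcs 3 n)\<inverse> \<union>
     P ` {..<n} \<times> (R ` {..<n} \<union> S ` {..<n}) \<union> R ` {0, 1, 3} \<times> {X} \<union> {X} \<times> S ` {..<n}"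

text \<open>For \<open>i < n\<close> the ranks fall into blocks: \<open>P\<close> below
  \<open>n\<close>, \<open>R\<close> above \<open>n\<close> up to \<open>2 * n\<close>, then
  \<open>X\<close>, then \<open>S\<close>. Within \<open>R\<close> and \<open>S\<close> arcs go to
  smaller numbers, so \<open>i\<close> is subtracted.\<close>

fun rank43 :: "nat \<Rightarrow> vert \<Rightarrow> nat" where
  "rank43 n (P i) = i"
| "rank43 n (R i) = 2 * n - i"
| "rank43 n X = 2 * n + 1"
| "rank43 n (S i) = 3 * n + 2 - i"

lemma set_decode_0_1_3: "set_decode 0 = {}" "set_decode 1 = {0}" "set_decode 3 = {0, 1}"
  using set_encode_inverse[of "{0}"] set_encode_inverse[of "{0, 1}"] by (simp_all add: numeral_3_eq_3)

text \<open>\<open>P\<close> and \<open>X\<close> meet the bound on indegrees, \<open>R\<close> and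
  \<open>S\<close> the one on outdegrees. The extra arc to \<open>X\<close> leaves only 0, 1, 3 in
  \<open>R\<close>, which have at most two ones in binary.\<close>

lemma arcs43_degrees:
  "card {u. (u, P i) \<in> arcs43 n} \<le> 4" "card {w. (R i, w) \<in> arcs43 n} \<le> 3"
  "card {w. (S i, w) \<in> arcs43 n} \<le> 3" "card {u. (u, X) \<in> arcs43 n} \<le> 4"
proof -
  have image: "card (f ` set_decode i) \<le> card (set_decode i)" for f :: "nat \<Rightarrow> vert"
    by (rule card_image_le) simp
  have bound: "card A \<le> d" if "card (set_decode i) \<le> d \<Longrightarrow> A \<subseteq> f ` set_decode i" "\<not> card (set_decode i) \<le> d \<Longrightarrow> A = {}"
    for A and f :: "nat \<Rightarrow> vert" and d
  proof (cases "card (set_decode i) \<le> d")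
    case True
    then have "card A \<le> card (f ` set_decode i)" using that(1) by (intro card_mono) auto
    then show ?thesis using image[of f] True by linarith
  qed (use that(2) in simp)
  show "card {u. (u, P i) \<in> arcs43 n} \<le> 4"
    by (rule bound[of _ _ P]) (auto simp: arcs43_def universal_arcs_def)
  show "card {w. (S i, w) \<in> arcs43 n} \<le> 3"
    by (rule bound[of _ _ S]) (auto simp: arcs43_def universal_arcs_def)
  have "{u. (u, X) \<in> arcs43 n} = {R 0, R 1, R 3}" by (auto simp: arcs43_def)
  then show "card {u. (u, X) \<in> arcs43 n} \<le> 4" by simp
  show "card {w. (R i, w) \<in> arcs43 n} \<le> 3"
  proof (cases "i \<in> {0, 1, 3}")
    case True
    have "{w. (R i, w) \<in> arcs43 n} \<subseteq> insert X (R ` set_decode i)"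
      by (auto simp: arcs43_def universal_arcs_def)
    then have "card {w. (R i, w) \<in> arcs43 n} \<le> card (insert X (R ` set_decode i))"
      by (intro card_mono) auto
    also have "\<dots> \<le> Suc (card (R ` set_decode i))" by (simp add: card_insert_if)
    also have "\<dots> \<le> Suc (card (set_decode i))" using image[of R] by simp
    also have "\<dots> \<le> 3" using True by (auto simp: set_decode_0_1_3 simp del: One_nat_def)
    finally show ?thesis .
  next
    case False
    then show ?thesis by (intro bound[of _ _ R]) (auto simp: arcs43_def universal_arcs_def)
  qed
qed

lemma cut_number_4_3_gt: "cut_number 4 3 > 4"
proof (rule ccontr)
  assume "\<not> ?thesis"
  then have le: "cut_number 4 3 \<le> 4" by simp
  define n where "n = stage (Suc (card (Pow {1..4::nat})))"
  have n4: "4 \<le> n" using stage_mono[of 0 "Suc (card (Pow {1..4::nat}))"] by (simp add: stage_def n_def)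
  define D where "D = \<lparr>pverts = P ` {..<n} \<union> R ` {..<n} \<union> S ` {..<n} \<union> {X}, parcs = arcs43 n\<rparr>"
  have "D \<in> digraph_class 4 3"
  proof (rule digraph_classI[of D "rank43 n"])
    show "parcs D \<subseteq> pverts D \<times> pverts D"
      using n4 by (auto simp: D_def arcs43_def universal_arcs_def dest!: less_of_mem_set_decode)
    show "parcs D \<subseteq> measure (rank43 n)"
      using n4 by (auto simp: D_def arcs43_def universal_arcs_def dest!: less_of_mem_set_decode)
    show "int (card {u. (u, v) \<in> parcs D}) \<le> 4 \<or> int (card {w. (v, w) \<in> parcs D}) \<le> 3" for v
      using arcs43_degrees by (cases v) (simp_all add: D_def)
  qed (simp add: D_def)
  then obtain C :: "vert \<Rightarrow> nat set"
    where C: "\<And>v. C v \<subseteq> {1..4}" "\<And>u v. (u, v) \<in> parcs D \<Longrightarrow> \<not> C u \<subseteq> C v"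
    using labeling_of_cut_number[OF _ le] by blast
  have arc: "\<not> C u \<subseteq> C v" if "(u, v) \<in> arcs43 n" for u v
    using C(2)[of u v] that by (simp add: D_def)
  have fin: "finite (C v)" for v using C(1) finite_subset by blast
  have range: "(C \<circ> f) ` B \<subseteq> Pow {1..4}" for f :: "nat \<Rightarrow> vert" and B using C(1) by auto
  obtain bP where bP: "bP \<le> n" "undominated (\<subseteq>) 4 ((C \<circ> P) ` {..<bP})"
  proof (rule undominated_stage[of "Pow {1..4}" "C \<circ> P" 4 "(\<subseteq>)"])
    show "\<not> (C \<circ> P) i \<subseteq> (C \<circ> P) j"
      if "j < stage (Suc (card (Pow {1..4::nat})))" "i \<in> set_decode j" "card (set_decode j) \<le> 4" for i j
      unfolding comp_def using that by (intro arc) (auto simp: arcs43_def universal_arcs_def n_def)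
  qed (use C(1) in \<open>auto simp: n_def\<close>)
  \<comment> \<open>Arcs in \<open>R\<close> are reversed, so \<open>j\<close> codes out-neighbours
    and the order is \<open>(\<supseteq>)\<close>.\<close>
  obtain bR where bR: "4 \<le> bR" "bR \<le> n" "undominated (\<supseteq>) 3 ((C \<circ> R) ` {..<bR})"
  proof (rule undominated_stage[of "Pow {1..4}" "C \<circ> R" 3 "(\<supseteq>)"])
    show "\<not> (C \<circ> R) i \<supseteq> (C \<circ> R) j"
      if "j < stage (Suc (card (Pow {1..4::nat})))" "i \<in> set_decode j" "card (set_decode j) \<le> 3" for i j
      unfolding comp_def using that by (intro arc) (auto simp: arcs43_def universal_arcs_def n_def)
  qed (use C(1) in \<open>auto simp: n_def\<close>)
  obtain bS where bS: "bS \<le> n" "undominated (\<supseteq>) 3 ((C \<circ> S) ` {..<bS})"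
  proof (rule undominated_stage[of "Pow {1..4}" "C \<circ> S" 3 "(\<supseteq>)"])
    show "\<not> (C \<circ> S) i \<supseteq> (C \<circ> S) j"
      if "j < stage (Suc (card (Pow {1..4::nat})))" "i \<in> set_decode j" "card (set_decode j) \<le> 3" for i j
      unfolding comp_def using that by (intro arc) (auto simp: arcs43_def universal_arcs_def n_def)
  qed (use C(1) in \<open>auto simp: n_def\<close>)
  have PR: "\<not> x \<subseteq> y" if "x \<in> (C \<circ> P) ` {..<bP}" "y \<in> (C \<circ> R) ` {..<bR}" for x y
    using that bP(1) bR(2) by (auto intro!: arc simp: arcs43_def)
  have PS: "\<not> x \<subseteq> y" if "x \<in> (C \<circ> P) ` {..<bP}" "y \<in> (C \<circ> S) ` {..<bS}" for x y
    using that bP(1) bS(1) by (auto intro!: arc simp: arcs43_def)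
  \<comment> \<open>The labels of \<open>R\<close> below \<open>bR\<close> have at most one element,
    and the arc to \<open>X\<close> excludes the empty label.\<close>
  have single: "\<exists>a. C (R i) = {a} \<and> a \<notin> C X" if i: "i \<in> {0, 1, 3}" for i
  proof -
    have "i < bR" using i bR(1) by auto
    then have "card (C (R i)) \<le> 1"
      by (intro undominated_3_dual(1)[OF range bP(2) range bR(3) PR]) auto
    moreover have X: "\<not> C (R i) \<subseteq> C X" using i by (intro arc) (auto simp: arcs43_def)
    moreover have "card (C (R i)) \<noteq> 0" using X fin by auto
    ultimately have "card (C (R i)) = 1" by linarith
    then show ?thesis using X by (auto simp: card_1_singleton_iff)
  qed
  obtain a0 where a0: "C (R 0) = {a0}" "a0 \<notin> C X" using single[of 0] by auto
  obtain a1 where a1: "C (R 1) = {a1}" "a1 \<notin> C X" using single[of 1] by auto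
  obtain a3 where a3: "C (R 3) = {a3}" "a3 \<notin> C X" using single[of 3] by auto
  \<comment> \<open>These three arcs, reversed in \<open>R\<close>, form the transitive tournament
    that makes \<open>a0\<close>, \<open>a1\<close>, \<open>a3\<close> distinct.\<close>
  have "(0, 1) \<in> universal_arcs 3 n" "(0, 3) \<in> universal_arcs 3 n" "(1, 3) \<in> universal_arcs 3 n"
    using n4 by (simp_all add: universal_arcs_def set_decode_0_1_3 del: One_nat_def)
  moreover have "\<not> C (R j) \<subseteq> C (R i)" if "(i, j) \<in> universal_arcs 3 n" for i j
    using that by (intro arc) (auto simp: arcs43_def)
  ultimately have "\<not> C (R 1) \<subseteq> C (R 0)" "\<not> C (R 3) \<subseteq> C (R 0)" "\<not> C (R 3) \<subseteq> C (R 1)"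
    by blast+
  then have "card {a0, a1, a3} = 3" using a0 a1 a3 by auto
  moreover have "C X \<subseteq> {1..4} - {a0, a1, a3}" "{a0, a1, a3} \<subseteq> {1..4}"
    using C(1)[of X] C(1)[of "R 0"] C(1)[of "R 1"] C(1)[of "R 3"] a0 a1 a3 by auto
  ultimately have X1: "card (C X) \<le> 1"
    using card_mono[of "{1..4} - {a0, a1, a3}" "C X"] by (simp add: card_Diff_subset)
  have eq: "x = y" if "x \<in> C X" "y \<in> C X" for x y
    using X1 card_le_Suc0_iff_eq[OF fin[of X]] that by simp
  \<comment> \<open>If \<open>X\<close> has the empty label, any \<open>j\<close> serves. A vertex
    of \<open>S\<close> with label \<open>{j}\<close> then contradicts its arc from
    \<open>X\<close>.\<close>
  obtain j where j: "j \<in> {1..4}" "C X \<subseteq> {j}"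
  proof (cases "C X = {}")
    case True
    then show ?thesis using that[of 1] by simp
  next
    case False
    then obtain j where "j \<in> C X" by blast
    moreover from this have "C X \<subseteq> {j}" using eq by blast
    ultimately show ?thesis using that[of j] C(1)[of X] by blast
  qed
  have "{j} \<in> (C \<circ> S) ` {..<bS}" by (rule undominated_3_dual(2)[OF range bP(2) range bS(2) PS j(1)])
  then obtain m where m: "m < bS" "C (S m) = {j}" by auto
  have "\<not> C X \<subseteq> C (S m)" using m(1) bS(1) by (intro arc) (auto simp: arcs43_def)
  then show False using j(2) m(2) by simp
qed

theorem theorem2p4:
  shows "cut_number 5 2 \<le> 4 \<and> cut_number 3 3 \<le> 4 \<and>
         cut_number 6 (-1) > 4 \<and> cut_number 4 3 > 4"
  by (intro conjI cut_number_le covered_by_cuts_5_2 covered_by_cuts_3_3 cut_number_6_gt cut_number_4_3_gt)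

end
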